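(* In the density estimation setting of the context, let $\alpha\in(0,1)$, let $(d_n)$ be a deterministic sequence with $d_n\to\infty$ and $d_n/\log n\to\infty$, let $h_{\mathrm{nv}}=n^{-\frac1{2S+1}}$, and define $$\bar r(t)=d_n\Big(\frac{2\log(1/t)V_{ng}}{n}\Big)^{\frac S{2S+1}} .$$ Then $$\inf_{f_X\in\Theta_0(M_S,r_S,\psi_n)}\mathbb P\big(\widehat f_{h_{\mathrm{nv}}}(0)\ge f_X(0)-\bar r(\alpha)\big)\ge1-\alpha-\mathrm{CE}_n,$$ $$\inf_{f_X\in\Theta_0(M_S,r_S,\psi_n)}\mathbb P\big(f_X(0)\ge\widehat f_{h_{\mathrm{nv}}}(0)-\bar r(\alpha)\big)\ge1-\alpha-\mathrm{CE}_n,$$ $$\inf_{f_X\in\Theta_0(M_S,r_S,\psi_n)}\mathbb P\Big(f_X(0)\in\big[\widehat f_{h_{\mathrm{nv}}}(0)-\bar r(\tfrac\alpha2),\ \widehat f_{h_{\mathrm{nv}}}(0)+\bar r(\tfrac\alpha2)\big]\Big)\ge1-\alpha-\mathrm{CE}'_n,$$ where $\mathrm{CE}_n=O(e^{-n^{\kappa_1}})$ and $\mathrm{CE}_n'=O(e^{-n^{\kappa_2}})$ for some $\kappa_1,\kappa_2>0$.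
   Context: Let $S\ge1$ be an integer and $X_1,\dots,X_n$ ($n$ even) i.i.d. with Lebesgue density $f_X$, which is uniformly bounded away from $0$ (on its support). The point $0$ is an interior point or a (left or right) boundary point of the support of $f_X$. Kernel: $K_I$ is bounded with support $I$, where $I=[-1,1]$ in the interior case and $I=[0,1]$ or $I=[-1,0]$ in the left or right boundary case, and $\int_IK_I(u)du=1$, $\int_Iu^kK_I(u)du=0$ for $k=1,\dots,S$. Function class: with $\psi_n=n^{-1/(2S+1)}\log n$, $f_X\in\Theta_0(M_S,r_S,\psi_n)$, the set of functions $\theta$ such that $\big|\theta(\epsilon)-\theta(0)-\sum_{s=1}^S\frac{\theta^{(s)}(0)}{s!}\epsilon^s\big|\le M_S\,r_S(|\epsilon|)|\epsilon|^S$ for all $|\epsilon|\le\psi_n$ (with $\epsilon$ in the support), where $\theta^{(s)}(0)$ is the ordinary (one-sided at a boundary point) derivative; $r_S:[0,\infty)\to[0,\infty)$ is nondecreasing, does not depend on $\theta$, $r_S(t)\to0$ as $t\downarrow0$; $M_S>0$ is a constant not depending on $\theta,n$ or bandwidth. The infima run over densities in this class. Estimator: $\widehat f_h(0)=\frac1{nh}\sum_{i=1}^nK_I(X_i/h)$. Variance proxy: $V_{ng}=\frac1{ng}\sum_{i=1}^{n/2}\big(K_I(X_{2i}/g)-K_I(X_{2i-1}/g)\big)^2$ with $g=n^{-1/(2S+1)}$.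
   Formalization: The infima run over densities that also share a lower bound c, a window [-δ,δ] on which the support is an interval (two- or one-sided at 0), and an upper bound B on that window (all arbitrary constants); without the uniform upper bound and window the claim fails. *)

theory Defs
  imports "HOL-Probability.Probability" "HOL-Library.Landau_Symbols"
begin

definition supp :: "(real \<Rightarrow> real) \<Rightarrow> real set" where
  "supp f = {x. f x \<noteq> 0}"

text \<open>
  Iterated derivatives relative to a set \<open>A\<close>. At an interior point of \<open>A\<close> these are the usual
  derivatives; at an endpoint of an interval they are the one-sided ones.
\<close>

primrec nderiv_within :: "real set \<Rightarrow> nat \<Rightarrow> (real \<Rightarrow> real) \<Rightarrow> real \<Rightarrow> real" where
  "nderiv_within A 0 f = f"
| "nderiv_within A (Suc k) f = (\<lambda>x. vector_derivative (nderiv_within A k f) (at x within A))"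

text \<open>
  Derivatives of order below \<open>k\<close> exist at \<open>x\<close> and nearby, and the derivative of order \<open>k\<close> exists
  at \<open>x\<close> (not necessarily nearby).
\<close>

definition ndifferentiable_within :: "real set \<Rightarrow> nat \<Rightarrow> (real \<Rightarrow> real) \<Rightarrow> real \<Rightarrow> bool" where
  "ndifferentiable_within A k f x \<longleftrightarrow>
     (\<forall>j<k. nderiv_within A j f differentiable (at x within A)) \<and>
     (\<forall>j. Suc j < k \<longrightarrow>
        (\<forall>\<^sub>F y in at x within A. nderiv_within A j f differentiable (at y within A)))"

definition Theta0 :: "nat \<Rightarrow> real \<Rightarrow> (real \<Rightarrow> real) \<Rightarrow> real \<Rightarrow> (real \<Rightarrow> real) set" where
  "Theta0 S M r \<psi> = {\<theta>. ndifferentiable_within (supp \<theta>) S \<theta> 0 \<and>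
     (\<forall>\<epsilon>\<in>supp \<theta>. \<bar>\<epsilon>\<bar> \<le> \<psi> \<longrightarrow>
        \<bar>\<theta> \<epsilon> - \<theta> 0 - (\<Sum>s=1..S. nderiv_within (supp \<theta>) s \<theta> 0 / fact s * \<epsilon> ^ s)\<bar>
          \<le> M * r \<bar>\<epsilon>\<bar> * \<bar>\<epsilon>\<bar> ^ S)}"

text \<open>
  Lebesgue densities bounded below by \<open>c\<close> on their support. The set \<open>I\<close> is \<open>{-1..1}\<close>, \<open>{0..1}\<close> or
  \<open>{-1..0}\<close>; accordingly the condition on \<open>supp f \<inter> {-\<delta>..\<delta>}\<close> says that 0 is an interior point, a
  left boundary point or a right boundary point of the support. The constants \<open>c\<close>, \<open>\<delta>\<close> and \<open>B\<close> are
  common to all members of the class. For a single density that is (one-sidedly) continuous at 0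
  the local upper bound \<open>B\<close> exists automatically once \<open>\<delta>\<close> is small; only its uniformity is a
  restriction, and without it the coverage statements fail: heights of order
  \<open>n powr (1 / (2 * S + 1)) / ln n\<close> on the shrinking window around 0 would be admissible.
\<close>

definition densities ::
    "real set \<Rightarrow> real \<Rightarrow> real \<Rightarrow> real \<Rightarrow> (real \<Rightarrow> real) set" where
  "densities I c B \<delta> = {f. f \<in> borel_measurable borel \<and> (\<forall>x. 0 \<le> f x) \<and>
     (\<integral>\<^sup>+ x. ennreal (f x) \<partial>lborel) = 1 \<and>
     (\<forall>x\<in>supp f. c \<le> f x) \<and>
     supp f \<inter> {-\<delta>..\<delta>} = (\<lambda>u. \<delta> * u) ` I \<and>
     (\<forall>x\<in>{-\<delta>..\<delta>}. f x \<le> B)}"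

text \<open>The support of a kernel is taken in the topological sense, so that it may vanish at endpoints.\<close>

definition order_kernel :: "real set \<Rightarrow> nat \<Rightarrow> (real \<Rightarrow> real) \<Rightarrow> bool" where
  "order_kernel I S K \<longleftrightarrow> K \<in> borel_measurable borel \<and> bounded (range K) \<and> closure (supp K) = I \<and>
     (LINT u:I|lborel. K u) = 1 \<and> (\<forall>k\<in>{1..S}. (LINT u:I|lborel. u ^ k * K u) = 0)"

text \<open>
  The joint law of an i.i.d. sample of size \<open>n\<close> with density \<open>f\<close>; the i-th observation of the sample
  \<open>\<omega>\<close> is \<open>\<omega> i\<close>, for \<open>i = 1, \<dots>, n\<close>.
\<close>

definition sample :: "nat \<Rightarrow> (real \<Rightarrow> real) \<Rightarrow> (nat \<Rightarrow> real) measure" where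
  "sample n f = (\<Pi>\<^sub>M i\<in>{1..n}. density lborel (\<lambda>x. ennreal (f x)))"

definition psi :: "nat \<Rightarrow> nat \<Rightarrow> real" where
  "psi S n = real n powr (- 1 / (2 * real S + 1)) * ln (real n)"

definition h_nv :: "nat \<Rightarrow> nat \<Rightarrow> real" where
  "h_nv S n = real n powr (- 1 / (2 * real S + 1))"

definition fhat :: "(real \<Rightarrow> real) \<Rightarrow> nat \<Rightarrow> real \<Rightarrow> (nat \<Rightarrow> real) \<Rightarrow> real" where
  "fhat K n h \<omega> = 1 / (real n * h) * (\<Sum>i=1..n. K (\<omega> i / h))"

definition V_proxy :: "(real \<Rightarrow> real) \<Rightarrow> nat \<Rightarrow> real \<Rightarrow> (nat \<Rightarrow> real) \<Rightarrow> real" where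
  "V_proxy K n g \<omega> =
     1 / (real n * g) * (\<Sum>i=1..n div 2. (K (\<omega> (2 * i) / g) - K (\<omega> (2 * i - 1) / g))\<^sup>2)"

definition rbar ::
    "nat \<Rightarrow> (real \<Rightarrow> real) \<Rightarrow> (nat \<Rightarrow> real) \<Rightarrow> nat \<Rightarrow> real \<Rightarrow> (nat \<Rightarrow> real) \<Rightarrow> real" where
  "rbar S K d n t \<omega> =
     d n * (2 * ln (1 / t) * V_proxy K n (real n powr (- 1 / (2 * real S + 1))) \<omega> / real n)
       powr (real S / (2 * real S + 1))"

end

theory Submission
  imports Defs
begin

text \<open>
  Write \<open>h = n powr (- 1 / (2 * S + 1))\<close> and \<open>p = S / (2 * S + 1)\<close>, so that
  \<open>h ^ S = n powr (- p)\<close> and \<open>n * h = n powr (2 * p)\<close>. This is the bandwidth at which bias and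
  standard deviation have the same order. The bias of the kernel estimator is \<open>O(h ^ S)\<close>: the
  Taylor polynomial of the density integrates against the kernel to its value at 0, and the
  remainder is controlled by the smoothness class (\<open>bias_bound\<close>). The variance is
  \<open>O(1 / (n * h))\<close>, hence by Chebyshev's inequality the estimator stays within a distance of order
  \<open>d n * n powr (- p)\<close> of its mean with probability tending to 1 (\<open>fhat_deviation\<close>), because
  \<open>d n\<close> tends to infinity.

  The half-width \<open>rbar\<close> is random, but not too small. The expected squared difference of two
  kernel values is \<open>2 * (E K\<^sup>2 - (E K)\<^sup>2)\<close>, where \<open>E K\<^sup>2\<close> is at least a positive constant times
  \<open>h\<close>, as the density is bounded below on its support, and \<open>(E K)\<^sup>2 = O(h\<^sup>2)\<close>, as it is bounded above
  near 0. So the mean of the variance proxy stays above a positive constant, and Chebyshev's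
  inequality again, now for the disjoint pairs of observations, shows that the proxy itself exceeds half of that constant with probability
  tending to 1 (\<open>V_proxy_lower_tail\<close>). On this event \<open>rbar\<close> is at least a constant times
  \<open>d n * n powr (- p)\<close>, which dominates bias plus deviation (\<open>coverage\<close>).

  All these bounds involve the density only through the constants of the class, so the probability
  that the error exceeds \<open>rbar\<close> tends to 0 uniformly over the class. From some sample size \<open>N\<close> on it
  is therefore below the nominal level \<open>\<alpha>\<close> (\<open>uniform_coverage\<close>). For \<open>n \<ge> N\<close> the stated coverage
  holds without any error term, for \<open>n < N\<close> the error term 1 makes the bound trivial, and an
  error term that vanishes eventually is \<open>O(exp (- n))\<close>. The two-sided interval contains the set
  where the error is at most \<open>rbar\<close> at level \<open>\<alpha>\<close>, since \<open>rbar\<close> grows as the level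
  decreases once \<open>d n \<ge> 0\<close>.
\<close>

section \<open>Sums of pairwise independent variables on product spaces\<close>

text \<open>
  Pairwise independence makes the mixed terms of the variance of the sum vanish, and each variance
  is at most the second moment.
\<close>

lemma (in prob_space) Chebyshev_sum_pairwise_indep:
  fixes X :: "'i \<Rightarrow> 'a \<Rightarrow> real"
  assumes fin: "finite J"
    and rv: "\<And>j. j \<in> J \<Longrightarrow> random_variable borel (X j)"
    and bnd: "\<And>j \<omega>. j \<in> J \<Longrightarrow> \<bar>X j \<omega>\<bar> \<le> C"
    and indep: "\<And>i j. i \<in> J \<Longrightarrow> j \<in> J \<Longrightarrow> i \<noteq> j \<Longrightarrow> indep_var borel (X i) borel (X j)"
    and sq: "\<And>j. j \<in> J \<Longrightarrow> expectation (\<lambda>\<omega>. (X j \<omega>)\<^sup>2) \<le> w"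
    and "a > 0"
  shows "prob {\<omega>\<in>space M. a \<le> \<bar>(\<Sum>j\<in>J. X j \<omega>) - (\<Sum>j\<in>J. expectation (X j))\<bar>}
           \<le> real (card J) * w / a\<^sup>2"
proof -
  have int: "integrable M (X j)" if "j \<in> J" for j
    using that rv bnd by (intro integrable_const_bound[where B=C]) auto
  define Y where "Y j \<omega> = X j \<omega> - expectation (X j)" for j \<omega>
  have prod: "integrable M (\<lambda>\<omega>. X i \<omega> * X j \<omega>)" if "i \<in> J" "j \<in> J" for i j
  proof (rule integrable_const_bound[where B="C * C"])
    show "AE \<omega> in M. norm (X i \<omega> * X j \<omega>) \<le> C * C"
    proof (rule AE_I2)
      fix \<omega>
      have "0 \<le> C"
        using bnd[OF that(1), of \<omega>] by linarith
      then show "norm (X i \<omega> * X j \<omega>) \<le> C * C"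
        using that bnd by (auto simp: abs_mult intro!: mult_mono)
    qed
    show "random_variable borel (\<lambda>\<omega>. X i \<omega> * X j \<omega>)"
      using that rv by measurable
  qed
  have Yprod: "expectation (\<lambda>\<omega>. Y i \<omega> * Y j \<omega>)
      = expectation (\<lambda>\<omega>. X i \<omega> * X j \<omega>) - expectation (X i) * expectation (X j)"
    and Yint: "integrable M (\<lambda>\<omega>. Y i \<omega> * Y j \<omega>)" if "i \<in> J" "j \<in> J" for i j
  proof -
    have eq: "(\<lambda>\<omega>. Y i \<omega> * Y j \<omega>) = (\<lambda>\<omega>. X i \<omega> * X j \<omega> - expectation (X j) * X i \<omega>
        - expectation (X i) * X j \<omega> + expectation (X i) * expectation (X j))"
      by (auto simp: Y_def algebra_simps)
    show "integrable M (\<lambda>\<omega>. Y i \<omega> * Y j \<omega>)"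
      unfolding eq using int that prod by (intro Bochner_Integration.integrable_add
          Bochner_Integration.integrable_diff integrable_mult_right) auto
    show "expectation (\<lambda>\<omega>. Y i \<omega> * Y j \<omega>)
      = expectation (\<lambda>\<omega>. X i \<omega> * X j \<omega>) - expectation (X i) * expectation (X j)"
      unfolding eq using int that prod by (simp add: prob_space algebra_simps)
  qed
  have Ypair: "expectation (\<lambda>\<omega>. Y i \<omega> * Y j \<omega>) \<le> (if i = j then w else 0)"
    if "i \<in> J" "j \<in> J" for i j
  proof (cases "i = j")
    case True
    have "expectation (\<lambda>\<omega>. Y i \<omega> * Y j \<omega>)
        = expectation (\<lambda>\<omega>. (X j \<omega>)\<^sup>2) - (expectation (X j))\<^sup>2"
      using Yprod[OF that] True by (simp add: power2_eq_square)
    then show ?thesis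
      using sq[OF that(2)] zero_le_power2[of "expectation (X j)"] unfolding if_P[OF True] by linarith
  next
    case False
    then show ?thesis
      using Yprod[OF that] indep_var_lebesgue_integral[OF indep[OF that False] int[OF that(1)] int[OF that(2)]]
      by simp
  qed
  have sumY: "(\<Sum>j\<in>J. X j \<omega>) - (\<Sum>j\<in>J. expectation (X j)) = (\<Sum>j\<in>J. Y j \<omega>)" for \<omega>
    by (simp add: Y_def sum_subtractf)
  have sq_eq: "(\<Sum>j\<in>J. Y j \<omega>)\<^sup>2 = (\<Sum>i\<in>J. \<Sum>j\<in>J. Y i \<omega> * Y j \<omega>)" for \<omega>
    by (simp add: power2_eq_square sum_product)
  have "prob {\<omega>\<in>space M. a \<le> \<bar>(\<Sum>j\<in>J. X j \<omega>) - (\<Sum>j\<in>J. expectation (X j))\<bar>}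
      \<le> expectation (\<lambda>\<omega>. (\<Sum>j\<in>J. Y j \<omega>)\<^sup>2) / a\<^sup>2"
    unfolding sumY
  proof (rule second_moment_method)
    show "random_variable borel (\<lambda>\<omega>. \<Sum>j\<in>J. Y j \<omega>)"
      unfolding Y_def using rv by measurable
    show "integrable M (\<lambda>\<omega>. (\<Sum>j\<in>J. Y j \<omega>)\<^sup>2)"
      unfolding sq_eq using Yint by (intro Bochner_Integration.integrable_sum) auto
  qed fact
  also have "expectation (\<lambda>\<omega>. (\<Sum>j\<in>J. Y j \<omega>)\<^sup>2)
      = (\<Sum>i\<in>J. \<Sum>j\<in>J. expectation (\<lambda>\<omega>. Y i \<omega> * Y j \<omega>))"
    unfolding sq_eq using Yint by (simp add: Bochner_Integration.integral_sum)
  also have "\<dots> \<le> (\<Sum>i\<in>J. \<Sum>j\<in>J. if i = j then w else 0)"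
    using Ypair by (intro sum_mono) auto
  also have "\<dots> = real (card J) * w"
    using fin by (simp add: sum.delta)
  finally show ?thesis
    using \<open>a > 0\<close> by (simp add: divide_right_mono)
qed

text \<open>
  The statistics that occur here depend on single observations or on disjoint pairs of them;
  both cases are instances of functions of disjoint blocks of coordinates.
\<close>

lemma indep_var_PiM_blocks:
  assumes P: "\<And>i. i \<in> J \<Longrightarrow> prob_space (D i)"
    and AB: "A \<inter> B = {}" "A \<subseteq> J" "B \<subseteq> J" and "J \<noteq> {}"
    and Y: "Y \<in> measurable (PiM A D) N" and Z: "Z \<in> measurable (PiM B D) N'"
  shows "prob_space.indep_var (PiM J D) N (\<lambda>\<omega>. Y (restrict \<omega> A)) N' (\<lambda>\<omega>. Z (restrict \<omega> B))"
proof -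
  interpret prob_space "PiM J D"
    using P by (rule prob_space_PiM)
  have "distr (PiM J D) (PiM J D) (\<lambda>x. \<lambda>i\<in>J. x i) = distr (PiM J D) (PiM J D) (\<lambda>x. x)"
    by (intro distr_cong) (auto simp: space_PiM)
  also have "\<dots> = PiM J D"
    by (rule distr_id)
  also have "\<dots> = PiM J (\<lambda>i. distr (PiM J D) (D i) (\<lambda>x. x i))"
    by (intro PiM_cong refl distr_PiM_component[symmetric] P)
  finally have "indep_vars D (\<lambda>i \<omega>. \<omega> i) J"
    using \<open>J \<noteq> {}\<close> by (subst indep_vars_iff_distr_eq_PiM') auto
  from indep_var_compose[OF indep_var_restrict[OF this AB] Y Z] show ?thesis
    by (simp add: comp_def)
qed

lemma integral_PiM_component:
  fixes \<phi> :: "'a \<Rightarrow> real"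
  assumes "\<And>i. i \<in> J \<Longrightarrow> prob_space (D i)" "i \<in> J" "\<phi> \<in> borel_measurable (D i)"
  shows "(\<integral>\<omega>. \<phi> (\<omega> i) \<partial>PiM J D) = (\<integral>x. \<phi> x \<partial>D i)"
proof -
  have "(\<integral>x. \<phi> x \<partial>D i) = (\<integral>x. \<phi> x \<partial>distr (PiM J D) (D i) (\<lambda>\<omega>. \<omega> i))"
    using assms by (simp add: distr_PiM_component)
  also have "\<dots> = (\<integral>\<omega>. \<phi> (\<omega> i) \<partial>PiM J D)"
    using assms by (intro integral_distr) auto
  finally show ?thesis ..
qed

section \<open>The law of a sample\<close>

lemma prob_space_density_member:
  assumes "f \<in> densities I c B \<delta>"
  shows "prob_space (density lborel (\<lambda>x. ennreal (f x)))"
  using assms by (intro prob_spaceI) (simp add: densities_def emeasure_density)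

lemma prob_space_sample:
  assumes "f \<in> densities I c B \<delta>"
  shows "prob_space (sample n f)"
  unfolding sample_def by (intro prob_space_PiM prob_space_density_member[OF assms])

lemma sample_component [measurable]:
  assumes "i \<in> {1..n}"
  shows "(\<lambda>\<omega>. \<omega> i) \<in> borel_measurable (sample n f)"
proof -
  have eq: "sets (sample n f) = sets (PiM {1..n} (\<lambda>_. borel))"
    unfolding sample_def by (intro sets_PiM_cong) auto
  show ?thesis
    unfolding measurable_cong_sets[OF eq refl] using assms by (rule measurable_component_singleton)
qed

lemma fhat_measurable [measurable]:
  assumes [measurable]: "K \<in> borel_measurable borel"
  shows "fhat K n h \<in> borel_measurable (sample n f)"
  unfolding fhat_def[abs_def] by measurable

lemma V_proxy_measurable [measurable]:
  assumes "K \<in> borel_measurable borel"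
  shows "V_proxy K n h \<in> borel_measurable (sample n f)"
  unfolding V_proxy_def[abs_def]
  by (intro borel_measurable_times borel_measurable_const borel_measurable_sum borel_measurable_power
      borel_measurable_diff measurable_compose[OF _ assms] borel_measurable_divide sample_component) auto

lemma rbar_measurable [measurable]:
  assumes [measurable]: "K \<in> borel_measurable borel"
  shows "rbar S K d n t \<in> borel_measurable (sample n f)"
  unfolding rbar_def[abs_def] by measurable

section \<open>Kernels and rescaled moments\<close>

locale bounded_kernel =
  fixes I :: "real set" and K :: "real \<Rightarrow> real" and C :: real
  assumes I: "I = {-1..1} \<or> I = {0..1} \<or> I = {-1..0}"
    and K_meas [measurable]: "K \<in> borel_measurable borel"
    and K_bound: "\<bar>K u\<bar> \<le> C"
    and K_outside: "u \<notin> I \<Longrightarrow> K u = 0"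
begin

definition "m1 = (\<integral>u. \<bar>K u\<bar> \<partial>lborel)"
definition "m2 = (\<integral>u. (K u)\<^sup>2 \<partial>lborel)"

lemma I_meas [measurable]: "I \<in> sets borel" and zero_in_I: "0 \<in> I" and abs_I: "u \<in> I \<Longrightarrow> \<bar>u\<bar> \<le> 1"
  and scale_I: "u \<in> I \<Longrightarrow> 0 \<le> s \<Longrightarrow> s \<le> 1 \<Longrightarrow> s * u \<in> I"
  and finite_I: "emeasure lborel I < \<infinity>"
proof -
  show "I \<in> sets borel" "0 \<in> I" "u \<in> I \<Longrightarrow> \<bar>u\<bar> \<le> 1" "emeasure lborel I < \<infinity>" using I by auto
  assume "u \<in> I" "0 \<le> s" "s \<le> 1"
  then have "\<bar>s * u\<bar> \<le> 1"
    using I by (auto simp: abs_mult intro!: mult_le_one)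
  moreover have "u \<ge> 0 \<Longrightarrow> s * u \<ge> 0" "u \<le> 0 \<Longrightarrow> s * u \<le> 0"
    using \<open>0 \<le> s\<close> by (auto simp: mult_nonneg_nonpos)
  ultimately show "s * u \<in> I"
    using I \<open>u \<in> I\<close> by auto
qed

lemma C_nonneg: "0 \<le> C"
  using K_bound[of 0] by linarith

lemma integrable_bounded_on_I:
  fixes \<phi> :: "real \<Rightarrow> real"
  assumes [measurable]: "\<phi> \<in> borel_measurable borel"
    and "\<And>u. u \<in> I \<Longrightarrow> \<bar>\<phi> u\<bar> \<le> b" and "\<And>u. u \<notin> I \<Longrightarrow> \<phi> u = 0"
  shows "integrable lborel \<phi>"
proof (rule Bochner_Integration.integrable_bound)
  show "integrable lborel (\<lambda>u. b * indicator I u)"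
    using finite_I by (intro integrable_mult_right integrable_real_indicator) auto
  show "AE u in lborel. norm (\<phi> u) \<le> norm (b * indicator I u)"
  proof (rule AE_I2)
    show "norm (\<phi> u) \<le> norm (b * indicator I u)" for u
      using assms(2)[of u] assms(3)[of u] by (cases "u \<in> I") auto
  qed
qed auto

lemma integrable_abs_K: "integrable lborel (\<lambda>u. \<bar>K u\<bar>)"
  using K_bound K_outside by (intro integrable_bounded_on_I[where b=C]) auto

lemma K_sq_bound: "(K u)\<^sup>2 \<le> C\<^sup>2"
  using K_bound[of u] by (simp add: abs_le_square_iff[symmetric])

lemma integrable_K_sq: "integrable lborel (\<lambda>u. (K u)\<^sup>2)"
  using K_sq_bound K_outside by (intro integrable_bounded_on_I[where b="C\<^sup>2"]) auto

text \<open>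
  This is what keeps the variance proxy away from 0: a kernel of nonzero integral cannot vanish almost
  everywhere.
\<close>

lemma m2_pos:
  assumes "(\<integral>u. K u \<partial>lborel) \<noteq> 0"
  shows "m2 > 0"
proof -
  have "m2 \<noteq> 0"
  proof
    assume "m2 = 0"
    then have "AE u in lborel. (K u)\<^sup>2 = 0"
      unfolding m2_def using integral_nonneg_eq_0_iff_AE[OF integrable_K_sq] by simp
    then have "(\<integral>u. K u \<partial>lborel) = (\<integral>u. 0 \<partial>(lborel::real measure))"
      by (intro integral_cong_AE) auto
    with assms show False by simp
  qed
  moreover have "m2 \<ge> 0" unfolding m2_def by simp
  ultimately show ?thesis by simp
qed

end

text \<open>
  A bandwidth \<open>h \<le> \<delta>\<close> places the rescaled window \<open>h * I\<close> inside the part of the support on which the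
  density is bounded from both sides.
\<close>

locale kernel_density = bounded_kernel +
  fixes f :: "real \<Rightarrow> real" and c B \<delta> h :: real
  assumes f: "f \<in> densities I c B \<delta>" and \<delta>: "0 < \<delta>" and c: "0 < c"
    and h: "0 < h" "h \<le> \<delta>"
begin

abbreviation "D \<equiv> density lborel (\<lambda>x. ennreal (f x))"

lemma f_meas [measurable]: "f \<in> borel_measurable borel" and f_nonneg: "0 \<le> f x"
  using f by (auto simp: densities_def)

lemmas prob_space_D = prob_space_density_member[OF f]

lemma f_bounds:
  assumes "u \<in> I"
  shows "c \<le> f (h * u)" "f (h * u) \<le> B" "h * u \<in> supp f"
proof -
  \<comment> \<open>\<open>I\<close> is star-shaped about 0, so \<open>h * I\<close> lies in \<open>\<delta> * I\<close>\<close>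
  have "(h / \<delta>) * u \<in> I"
    using assms h \<delta> by (intro scale_I) auto
  then have *: "h * u \<in> (\<lambda>u. \<delta> * u) ` I"
    using \<delta> by (intro image_eqI[where x="(h / \<delta>) * u"]) auto
  then have "h * u \<in> supp f \<inter> {-\<delta>..\<delta>}"
    using f by (simp add: densities_def)
  then show "c \<le> f (h * u)" "f (h * u) \<le> B" "h * u \<in> supp f"
    using f by (auto simp: densities_def)
qed

lemma integral_rescaled:
  assumes [measurable]: "\<phi> \<in> borel_measurable borel"
  shows "(\<integral>x. \<phi> (x / h) \<partial>D) = h * (\<integral>u. \<phi> u * f (h * u) \<partial>lborel)"
proof -
  have "(\<integral>x. \<phi> (x / h) \<partial>D) = (\<integral>x. f x * \<phi> (x / h) \<partial>lborel)"
    using f_nonneg by (subst integral_density) auto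
  also have "\<dots> = h * (\<integral>u. \<phi> u * f (h * u) \<partial>lborel)"
    using h by (subst lborel_integral_real_affine[where c=h and t=0]) (auto simp: mult.commute)
  finally show ?thesis .
qed

lemma integrable_weighted:
  fixes \<phi> :: "real \<Rightarrow> real"
  assumes [measurable]: "\<phi> \<in> borel_measurable borel"
    and "\<And>u. \<bar>\<phi> u\<bar> \<le> b" and "\<And>u. u \<notin> I \<Longrightarrow> \<phi> u = 0"
  shows "integrable lborel (\<lambda>u. \<phi> u * f (h * u))"
proof (rule integrable_bounded_on_I[where b="b * B"])
  show "\<bar>\<phi> u * f (h * u)\<bar> \<le> b * B" if "u \<in> I" for u
    using assms(2)[of u] f_bounds[OF that] f_nonneg[of "h * u"] by (auto simp: abs_mult intro!: mult_mono)
qed (use assms(3) in auto)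

lemma second_moment_bounds:
  shows "h * c * m2 \<le> (\<integral>x. (K (x / h))\<^sup>2 \<partial>D)" "(\<integral>x. (K (x / h))\<^sup>2 \<partial>D) \<le> h * B * m2"
proof -
  have eq: "(\<integral>x. (K (x / h))\<^sup>2 \<partial>D) = h * (\<integral>u. (K u)\<^sup>2 * f (h * u) \<partial>lborel)"
    by (rule integral_rescaled) measurable
  have int: "integrable lborel (\<lambda>u. (K u)\<^sup>2 * f (h * u))"
    using K_sq_bound K_outside by (intro integrable_weighted[where b="C\<^sup>2"]) auto
  have pt: "(K u)\<^sup>2 * c \<le> (K u)\<^sup>2 * f (h * u) \<and> (K u)\<^sup>2 * f (h * u) \<le> (K u)\<^sup>2 * B" for u
    using f_bounds[of u] K_outside[of u] by (cases "u \<in> I") (auto intro!: mult_left_mono)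
  have "c * m2 = (\<integral>u. (K u)\<^sup>2 * c \<partial>lborel)" "B * m2 = (\<integral>u. (K u)\<^sup>2 * B \<partial>lborel)"
    by (simp_all add: m2_def)
  moreover have "(\<integral>u. (K u)\<^sup>2 * c \<partial>lborel) \<le> (\<integral>u. (K u)\<^sup>2 * f (h * u) \<partial>lborel)"
    using int integrable_K_sq pt by (intro integral_mono) auto
  moreover have "(\<integral>u. (K u)\<^sup>2 * f (h * u) \<partial>lborel) \<le> (\<integral>u. (K u)\<^sup>2 * B \<partial>lborel)"
    using int integrable_K_sq pt by (intro integral_mono) auto
  ultimately have "c * m2 \<le> (\<integral>u. (K u)\<^sup>2 * f (h * u) \<partial>lborel)"
    "(\<integral>u. (K u)\<^sup>2 * f (h * u) \<partial>lborel) \<le> B * m2"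
    by linarith+
  then show "h * c * m2 \<le> (\<integral>x. (K (x / h))\<^sup>2 \<partial>D)" "(\<integral>x. (K (x / h))\<^sup>2 \<partial>D) \<le> h * B * m2"
    unfolding eq using h by (simp_all add: mult.assoc)
qed

text \<open>
  The squared mean is of order \<open>h\<^sup>2\<close>, negligible against the second moment, which is of order \<open>h\<close>.
\<close>

lemma first_moment_bound: "\<bar>\<integral>x. K (x / h) \<partial>D\<bar> \<le> h * (B * m1)"
proof -
  have "\<bar>\<integral>u. K u * f (h * u) \<partial>lborel\<bar> \<le> (\<integral>u. \<bar>K u * f (h * u)\<bar> \<partial>lborel)"
    by (rule integral_abs_bound)
  also have "\<dots> \<le> (\<integral>u. \<bar>K u\<bar> * B \<partial>lborel)"
  proof (rule integral_mono)
    show "integrable lborel (\<lambda>u. \<bar>K u * f (h * u)\<bar>)"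
      using K_bound K_outside by (intro integrable_abs integrable_weighted[where b=C]) auto
    show "integrable lborel (\<lambda>u. \<bar>K u\<bar> * B)"
      using integrable_abs_K by simp
    show "\<bar>K u * f (h * u)\<bar> \<le> \<bar>K u\<bar> * B" for u
      using f_bounds[of u] f_nonneg[of "h * u"] K_outside[of u]
      by (cases "u \<in> I") (auto simp: abs_mult intro!: mult_left_mono)
  qed
  also have "\<dots> = B * m1"
    by (simp add: m1_def)
  finally show ?thesis
    using h by (subst integral_rescaled) (auto simp: abs_mult intro!: mult_left_mono)
qed

section \<open>Deviations of the estimator and of the variance proxy\<close>

lemma expectation_component:
  fixes \<phi> :: "real \<Rightarrow> real"
  assumes "i \<in> {1..n}" "\<phi> \<in> borel_measurable borel"
  shows "(\<integral>\<omega>. \<phi> (\<omega> i) \<partial>sample n f) = (\<integral>x. \<phi> x \<partial>D)"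
  unfolding sample_def
  using integral_PiM_component[of "{1..n}" "\<lambda>_. D" i \<phi>] assms prob_space_D by simp

lemma indep_components:
  assumes "A \<inter> A' = {}" "A \<subseteq> {1..n}" "A' \<subseteq> {1..n}" "n > 0"
    and "Y \<in> borel_measurable (PiM A (\<lambda>_. D))" "Z \<in> borel_measurable (PiM A' (\<lambda>_. D))"
    and "\<And>\<omega>. Y (restrict \<omega> A) = Y' \<omega>" "\<And>\<omega>. Z (restrict \<omega> A') = Z' \<omega>"
  shows "prob_space.indep_var (sample n f) borel Y' borel Z'"
proof -
  have "{1..n} \<noteq> {}" using \<open>n > 0\<close> by auto
  from indep_var_PiM_blocks[OF prob_space_D assms(1-3) this assms(5,6)]
  show ?thesis unfolding sample_def assms(7,8) by simp
qed

lemma PiM_component_D: "i \<in> A \<Longrightarrow> (\<lambda>\<omega>. K (\<omega> i / h)) \<in> borel_measurable (PiM A (\<lambda>_. D))"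
  by (rule measurable_compose[OF measurable_component_singleton]) auto

lemma indep_kernel_values:
  assumes "i \<in> {1..n}" "j \<in> {1..n}" "i \<noteq> j"
  shows "prob_space.indep_var (sample n f) borel (\<lambda>\<omega>. K (\<omega> i / h)) borel (\<lambda>\<omega>. K (\<omega> j / h))"
proof (rule indep_components[of "{i}" "{j}"])
  show "(\<lambda>\<omega>. K (\<omega> i / h)) \<in> borel_measurable (PiM {i} (\<lambda>_. D))"
    "(\<lambda>\<omega>. K (\<omega> j / h)) \<in> borel_measurable (PiM {j} (\<lambda>_. D))"
    by (rule PiM_component_D, simp)+
qed (use assms in auto)

lemma fhat_deviation:
  assumes "n > 0" "a > 0"
  shows "\<P>(\<omega> in sample n f. a \<le> \<bar>fhat K n h \<omega> - (\<integral>x. K (x / h) \<partial>D) / h\<bar>)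
           \<le> B * m2 / (real n * h * a\<^sup>2)"
proof -
  interpret prob_space "sample n f" by (rule prob_space_sample[OF f])
  let ?e = "\<integral>x. K (x / h) \<partial>D"
  let ?X = "\<lambda>i \<omega>. K (\<omega> i / h)"
  have nh: "real n * h > 0" using assms h by simp
  have e: "expectation (?X i) = ?e" if "i \<in> {1..n}" for i
    using that by (intro expectation_component[where \<phi>="\<lambda>x. K (x / h)"]) auto
  have "prob {\<omega>\<in>space (sample n f). real n * h * a \<le> \<bar>(\<Sum>i\<in>{1..n}. ?X i \<omega>) - (\<Sum>i\<in>{1..n}. expectation (?X i))\<bar>}
      \<le> real (card {1..n}) * (h * B * m2) / (real n * h * a)\<^sup>2"
  proof (rule Chebyshev_sum_pairwise_indep[where C=C])
    show "indep_var borel (?X i) borel (?X j)" if "i \<in> {1..n}" "j \<in> {1..n}" "i \<noteq> j" for i j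
      using that by (rule indep_kernel_values)
    show "expectation (\<lambda>\<omega>. (?X i \<omega>)\<^sup>2) \<le> h * B * m2" if "i \<in> {1..n}" for i
      using second_moment_bounds(2) expectation_component[OF that, of "\<lambda>x. (K (x / h))\<^sup>2"] by simp
  qed (use K_bound nh \<open>a > 0\<close> in auto)
  also have "{\<omega>\<in>space (sample n f). real n * h * a \<le> \<bar>(\<Sum>i\<in>{1..n}. ?X i \<omega>) - (\<Sum>i\<in>{1..n}. expectation (?X i))\<bar>}
      = {\<omega>\<in>space (sample n f). a \<le> \<bar>fhat K n h \<omega> - ?e / h\<bar>}"
  proof (intro Collect_cong conj_cong refl)
    fix \<omega>
    have "(\<Sum>i\<in>{1..n}. ?X i \<omega>) - (\<Sum>i\<in>{1..n}. expectation (?X i))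
        = real n * h * (fhat K n h \<omega> - ?e / h)"
      using e nh h by (simp add: fhat_def field_simps)
    then show "(real n * h * a \<le> \<bar>(\<Sum>i\<in>{1..n}. ?X i \<omega>) - (\<Sum>i\<in>{1..n}. expectation (?X i))\<bar>)
        = (a \<le> \<bar>fhat K n h \<omega> - ?e / h\<bar>)"
      using nh h by (simp add: abs_mult mult_le_cancel_left_pos)
  qed
  also have "real (card {1..n}) * (h * B * m2) / (real n * h * a)\<^sup>2 = B * m2 / (real n * h * a\<^sup>2)"
    using nh \<open>a > 0\<close> by (simp add: field_simps power2_eq_square)
  finally show ?thesis .
qed

text \<open>
  For small \<open>h\<close> the mean of the proxy is at least \<open>c * m2 / 2\<close>, so that a value below half of this is
  a deviation of at least \<open>c * m2 / 4\<close>. The summands are squares bounded by \<open>4 * C\<^sup>2\<close>, hence their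
  second moments are at most \<open>4 * C\<^sup>2\<close> times their means; this leaves a variance bound of
  order \<open>1 / (n * h)\<close>.
\<close>

lemma V_proxy_lower_tail:
  assumes "even n" "n > 0" "m2 > 0" and small: "h * (B * m1)\<^sup>2 \<le> c * m2 / 2"
  shows "\<P>(\<omega> in sample n f. V_proxy K n h \<omega> < c * m2 / 4)
           \<le> 64 * C\<^sup>2 * B / (c\<^sup>2 * m2 * (real n * h))"
proof -
  interpret prob_space "sample n f" by (rule prob_space_sample[OF f])
  let ?e = "\<integral>x. K (x / h) \<partial>D" and ?q = "\<integral>x. (K (x / h))\<^sup>2 \<partial>D"
  let ?W = "\<lambda>i \<omega>. K (\<omega> i / h)"
  let ?X = "\<lambda>i \<omega>. (?W (2 * i) \<omega> - ?W (2 * i - 1) \<omega>)\<^sup>2"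
  let ?J = "{1..n div 2}"
  have nh: "real n * h > 0" using assms h by simp
  have card: "real (card ?J) = real n / 2"
    using \<open>even n\<close> by auto
  have idx: "2 * i \<in> {1..n}" "2 * i - 1 \<in> {1..n}" if "i \<in> ?J" for i
    using that by auto
  have Wm: "random_variable borel (?W i)" if "i \<in> {1..n}" for i
    by (rule measurable_compose[OF sample_component[OF that]]) measurable
  have Wint: "integrable (sample n f) (?W i)" if "i \<in> {1..n}" for i
    using Wm[OF that] K_bound by (intro integrable_const_bound[where B=C]) auto
  have We: "expectation (?W i) = ?e" if "i \<in> {1..n}" for i
    using that by (intro expectation_component[where \<phi>="\<lambda>x. K (x / h)"]) auto
  have Wq: "expectation (\<lambda>\<omega>. (?W i \<omega>)\<^sup>2) = ?q" if "i \<in> {1..n}" for i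
    using that by (intro expectation_component[where \<phi>="\<lambda>x. (K (x / h))\<^sup>2"]) auto
  have Wsq: "integrable (sample n f) (\<lambda>\<omega>. (?W i \<omega>)\<^sup>2)" if "i \<in> {1..n}" for i
    using Wm[OF that] K_sq_bound by (intro integrable_const_bound[where B="C\<^sup>2"]) auto
  have Xm: "random_variable borel (?X i)" if "i \<in> ?J" for i
    using Wm[OF idx(1)[OF that]] Wm[OF idx(2)[OF that]] by measurable
  have Xb: "?X i \<omega> \<le> 4 * C\<^sup>2" for i :: nat and \<omega>
  proof -
    have "\<bar>?W (2 * i) \<omega> - ?W (2 * i - 1) \<omega>\<bar> \<le> 2 * C"
      using K_bound[of "\<omega> (2 * i) / h"] K_bound[of "\<omega> (2 * i - 1) / h"] by linarith
    then have "?X i \<omega> \<le> (2 * C)\<^sup>2"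
      using C_nonneg by (subst abs_le_square_iff[symmetric]) simp
    then show ?thesis by (simp add: power_mult_distrib)
  qed
  have Xe: "expectation (?X i) = 2 * (?q - ?e\<^sup>2)" if "i \<in> ?J" for i
  proof -
    note a = idx(1)[OF that] and b = idx(2)[OF that]
    have ne: "2 * i \<noteq> 2 * i - 1" using that by auto
    have "expectation (?X i) = expectation (\<lambda>\<omega>. (?W (2 * i) \<omega>)\<^sup>2 + (?W (2 * i - 1) \<omega>)\<^sup>2
        - 2 * (?W (2 * i) \<omega> * ?W (2 * i - 1) \<omega>))"
      by (intro Bochner_Integration.integral_cong) (auto simp: power2_diff)
    also have "\<dots> = ?q + ?q - 2 * (?e * ?e)"
      using Wsq[OF a] Wsq[OF b] Wq[OF a] Wq[OF b] We[OF a] We[OF b]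
        indep_var_integrable[OF indep_kernel_values[OF a b ne] Wint[OF a] Wint[OF b]]
        indep_var_lebesgue_integral[OF indep_kernel_values[OF a b ne] Wint[OF a] Wint[OF b]]
      by simp
    finally show ?thesis by (simp add: power2_eq_square)
  qed
  have Xint: "integrable (sample n f) (?X i)" if "i \<in> ?J" for i
    using Xm[OF that] Xb by (intro integrable_const_bound[where B="4 * C\<^sup>2"]) auto
  have "prob {\<omega>\<in>space (sample n f). real n * h * (c * m2 / 4)
        \<le> \<bar>(\<Sum>i\<in>?J. ?X i \<omega>) - (\<Sum>i\<in>?J. expectation (?X i))\<bar>}
      \<le> real (card ?J) * (8 * C\<^sup>2 * (h * B * m2)) / (real n * h * (c * m2 / 4))\<^sup>2"
  proof (rule Chebyshev_sum_pairwise_indep[where C="4 * C\<^sup>2"])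
    show "indep_var borel (?X i) borel (?X j)" if "i \<in> ?J" "j \<in> ?J" "i \<noteq> j" for i j
    proof (rule indep_components[of "{2 * i, 2 * i - 1}" "{2 * j, 2 * j - 1}" _ "?X i" "?X j"])
      show "{2 * i, 2 * i - 1} \<inter> {2 * j, 2 * j - 1} = {}"
        using that by (auto; presburger)
      show "{2 * i, 2 * i - 1} \<subseteq> {1..n}" "{2 * j, 2 * j - 1} \<subseteq> {1..n}"
        using idx[OF that(1)] idx[OF that(2)] by auto
      show "?X i \<in> borel_measurable (PiM {2 * i, 2 * i - 1} (\<lambda>_. D))"
        by (intro borel_measurable_power borel_measurable_diff PiM_component_D) auto
      show "?X j \<in> borel_measurable (PiM {2 * j, 2 * j - 1} (\<lambda>_. D))"
        by (intro borel_measurable_power borel_measurable_diff PiM_component_D) auto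
    qed (use \<open>n > 0\<close> in auto)
    show "expectation (\<lambda>\<omega>. (?X i \<omega>)\<^sup>2) \<le> 8 * C\<^sup>2 * (h * B * m2)" if "i \<in> ?J" for i
    proof -
      have "expectation (\<lambda>\<omega>. (?X i \<omega>)\<^sup>2) \<le> expectation (\<lambda>\<omega>. 4 * C\<^sup>2 * ?X i \<omega>)"
      proof (rule integral_mono)
        show "integrable (sample n f) (\<lambda>\<omega>. (?X i \<omega>)\<^sup>2)"
        proof (rule integrable_const_bound[where B="(4 * C\<^sup>2)\<^sup>2"])
          have "(?X i \<omega>)\<^sup>2 \<le> (4 * C\<^sup>2)\<^sup>2" for \<omega>
            by (rule power_mono[OF Xb]) simp
          then show "AE \<omega> in sample n f. norm ((?X i \<omega>)\<^sup>2) \<le> (4 * C\<^sup>2)\<^sup>2"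
            by (intro AE_I2) simp
        qed (use Xm[OF that] in measurable)
        show "integrable (sample n f) (\<lambda>\<omega>. 4 * C\<^sup>2 * ?X i \<omega>)"
          using Xint[OF that] by (rule integrable_mult_right)
        show "(?X i \<omega>)\<^sup>2 \<le> 4 * C\<^sup>2 * ?X i \<omega>" for \<omega>
          unfolding power2_eq_square[of "?X i \<omega>"] by (rule mult_right_mono[OF Xb]) simp
      qed
      also have "\<dots> = 8 * C\<^sup>2 * (?q - ?e\<^sup>2)"
        using Xe[OF that] by simp
      also have "\<dots> \<le> 8 * C\<^sup>2 * (h * B * m2)"
        using second_moment_bounds(2) zero_le_power2[of ?e]
        by (intro mult_left_mono) (linarith, simp)
      finally show ?thesis .
    qed
  qed (use Xm Xb nh \<open>m2 > 0\<close> c in auto)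
  moreover have "{\<omega>\<in>space (sample n f). V_proxy K n h \<omega> < c * m2 / 4}
      \<subseteq> {\<omega>\<in>space (sample n f). real n * h * (c * m2 / 4)
        \<le> \<bar>(\<Sum>i\<in>?J. ?X i \<omega>) - (\<Sum>i\<in>?J. expectation (?X i))\<bar>}"
  proof safe
    fix \<omega> assume "V_proxy K n h \<omega> < c * m2 / 4"
    then have 1: "(\<Sum>i\<in>?J. ?X i \<omega>) < real n * h * (c * m2 / 4)"
      using nh by (simp add: V_proxy_def field_simps)
    have "?e\<^sup>2 \<le> (h * (B * m1))\<^sup>2"
      using first_moment_bound by (subst abs_le_square_iff[symmetric]) linarith
    also have "\<dots> = h * (h * (B * m1)\<^sup>2)"
      by (simp add: power2_eq_square)
    also have "\<dots> \<le> h * (c * m2 / 2)"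
      using small h by (intro mult_left_mono) auto
    finally have "h * (c * m2 / 2) \<le> ?q - ?e\<^sup>2"
      using second_moment_bounds(1) by (simp add: mult.assoc)
    then have "real n * (h * (c * m2 / 2)) \<le> real n * (?q - ?e\<^sup>2)"
      by (rule mult_left_mono) simp
    also have "\<dots> = real (card ?J) * (2 * (?q - ?e\<^sup>2))"
      unfolding card by simp
    also have "\<dots> = (\<Sum>i\<in>?J. expectation (?X i))"
      by (simp only: Xe sum_constant cong: sum.cong)
    finally have 2: "2 * (real n * h * (c * m2 / 4)) \<le> (\<Sum>i\<in>?J. expectation (?X i))"
      by (simp add: ac_simps)
    from 1 2 show "real n * h * (c * m2 / 4)
        \<le> \<bar>(\<Sum>i\<in>?J. ?X i \<omega>) - (\<Sum>i\<in>?J. expectation (?X i))\<bar>"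
      by linarith
  qed
  moreover have "{\<omega>\<in>space (sample n f). real n * h * (c * m2 / 4)
        \<le> \<bar>(\<Sum>i\<in>?J. ?X i \<omega>) - (\<Sum>i\<in>?J. expectation (?X i))\<bar>} \<in> events"
  proof -
    have [measurable]: "random_variable borel (\<lambda>\<omega>. \<Sum>i\<in>?J. ?X i \<omega>)"
      using Xm by (rule borel_measurable_sum)
    show ?thesis by measurable
  qed
  ultimately have "prob {\<omega>\<in>space (sample n f). V_proxy K n h \<omega> < c * m2 / 4}
      \<le> real (card ?J) * (8 * C\<^sup>2 * (h * B * m2)) / (real n * h * (c * m2 / 4))\<^sup>2"
    by (meson finite_measure_mono order_trans)
  also have "\<dots> = 64 * C\<^sup>2 * B / (c\<^sup>2 * m2 * (real n * h))"
    unfolding card using nh \<open>m2 > 0\<close> c by (simp add: field_simps power2_eq_square)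
  finally show ?thesis .
qed

section \<open>Bias\<close>

text \<open>
  The constant term of the Taylor polynomial integrates to \<open>f 0\<close> and all higher terms to 0, so only
  the remainder contributes. Monotonicity of \<open>r\<close> and \<open>h \<le> 1\<close> bound the modulus by \<open>r 1\<close>.
\<close>

lemma bias_bound:
  assumes Th: "f \<in> Theta0 S M r \<psi>" and "h \<le> \<psi>" "h \<le> 1" "M > 0"
    and r: "mono_on {0..} r" and r_nonneg: "0 \<le> r 1"
    and one: "(\<integral>u. K u \<partial>lborel) = 1"
    and mom: "\<And>k. k \<in> {1..S} \<Longrightarrow> (\<integral>u. u ^ k * K u \<partial>lborel) = 0"
  shows "\<bar>(\<integral>x. K (x / h) \<partial>D) / h - f 0\<bar> \<le> M * r 1 * m1 * h ^ S"
proof -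
  let ?a = "\<lambda>s. nderiv_within (supp f) s f 0 / fact s * h ^ s"
  let ?R = "\<lambda>u. f (h * u) - f 0 - (\<Sum>s=1..S. ?a s * u ^ s)"
  have intKf: "integrable lborel (\<lambda>u. K u * f (h * u))"
    using K_bound K_outside by (intro integrable_weighted[where b=C]) auto
  have intK: "integrable lborel K"
    using K_bound K_outside by (intro integrable_bounded_on_I[where b=C]) auto
  have intm: "integrable lborel (\<lambda>u. u ^ k * K u)" for k
  proof (rule integrable_bounded_on_I[where b=C])
    fix u assume "u \<in> I"
    then have "\<bar>u\<bar> ^ k \<le> 1" by (intro power_le_one) (auto simp: abs_I)
    then have "\<bar>u\<bar> ^ k * \<bar>K u\<bar> \<le> 1 * C"
      using K_bound C_nonneg by (intro mult_mono) auto
    then show "\<bar>u ^ k * K u\<bar> \<le> C" by (simp add: abs_mult power_abs)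
  qed (use K_outside in auto)
  have KR: "(\<lambda>u. K u * ?R u) = (\<lambda>u. K u * f (h * u) - f 0 * K u - (\<Sum>s=1..S. ?a s * (u ^ s * K u)))"
    by (auto simp: algebra_simps sum_distrib_left)
  have intR: "integrable lborel (\<lambda>u. K u * ?R u)"
    unfolding KR using intKf intK intm
    by (intro Bochner_Integration.integrable_diff Bochner_Integration.integrable_sum integrable_mult_right) auto
  have "(\<integral>u. K u * ?R u \<partial>lborel)
      = (\<integral>u. K u * f (h * u) \<partial>lborel) - f 0 * 1 - (\<Sum>s=1..S. ?a s * (\<integral>u. u ^ s * K u \<partial>lborel))"
    unfolding KR using intKf intK intm one
    by (simp del: mult_1_right)
  also have "\<dots> = (\<integral>x. K (x / h) \<partial>D) / h - f 0"
    using h mom by (subst integral_rescaled) auto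
  finally have "\<bar>(\<integral>x. K (x / h) \<partial>D) / h - f 0\<bar> = \<bar>\<integral>u. K u * ?R u \<partial>lborel\<bar>"
    by simp
  also have "\<dots> \<le> (\<integral>u. \<bar>K u * ?R u\<bar> \<partial>lborel)"
    by (rule integral_abs_bound)
  also have "\<dots> \<le> (\<integral>u. \<bar>K u\<bar> * (M * r 1 * h ^ S) \<partial>lborel)"
  proof (rule integral_mono)
    show "integrable lborel (\<lambda>u. \<bar>K u * ?R u\<bar>)" using intR by (rule integrable_abs)
    show "integrable lborel (\<lambda>u. \<bar>K u\<bar> * (M * r 1 * h ^ S))"
      using integrable_abs_K by (rule integrable_mult_left)
    fix u
    show "\<bar>K u * ?R u\<bar> \<le> \<bar>K u\<bar> * (M * r 1 * h ^ S)"
    proof (cases "u \<in> I")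
      case True
      have le: "\<bar>h * u\<bar> \<le> h"
        using abs_I[OF True] h by (simp add: abs_mult mult_left_le)
      have "\<bar>?R u\<bar> \<le> M * r \<bar>h * u\<bar> * \<bar>h * u\<bar> ^ S"
        using Th f_bounds(3)[OF True] \<open>h \<le> \<psi>\<close>
      proof -
        have "\<bar>h * u\<bar> \<le> \<psi>"
          using le \<open>h \<le> \<psi>\<close> by linarith
        then have "\<bar>f (h * u) - f 0 - (\<Sum>s=1..S. nderiv_within (supp f) s f 0 / fact s * (h * u) ^ s)\<bar>
            \<le> M * r \<bar>h * u\<bar> * \<bar>h * u\<bar> ^ S"
          using Th f_bounds(3)[OF True] unfolding Theta0_def by blast
        then show ?thesis
          by (simp only: power_mult_distrib mult.assoc)
      qed
      also have "\<dots> \<le> M * r 1 * h ^ S"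
      proof -
        have "r \<bar>h * u\<bar> \<le> r 1"
          using le \<open>h \<le> 1\<close> by (intro mono_onD[OF r]) auto
        then have "M * r \<bar>h * u\<bar> \<le> M * r 1"
          using \<open>M > 0\<close> by simp
        moreover have "\<bar>h * u\<bar> ^ S \<le> h ^ S"
          using le by (intro power_mono) auto
        moreover have "0 \<le> M * r 1"
          using \<open>M > 0\<close> r_nonneg by simp
        ultimately show ?thesis
          by (rule mult_mono) auto
      qed
      finally show ?thesis
        by (simp add: abs_mult mult_left_mono)
    qed (simp add: K_outside)
  qed
  also have "\<dots> = M * r 1 * m1 * h ^ S"
    by (simp add: m1_def)
  finally show ?thesis .
qed

section \<open>Coverage\<close>

text \<open>
  The radius \<open>a\<close> is the part of the half-width reserved for the random error and \<open>b\<close> the part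
  reserved for the bias. The right-hand side of the last assumption is the value of \<open>rbar\<close> when the
  variance proxy equals the lower bound \<open>c * m2 / 4\<close>.
\<close>

lemma coverage:
  assumes "even n" "n > 0" "m2 > 0" "h * (B * m1)\<^sup>2 \<le> c * m2 / 2"
    and hn: "h = real n powr (- 1 / (2 * real S + 1))"
    and bias: "\<bar>(\<integral>x. K (x / h) \<partial>D) / h - f 0\<bar> \<le> b"
    and "a > 0" "d n \<ge> 0" "ln (1 / t) \<ge> 0"
    and le: "a + b \<le> d n * (2 * ln (1 / t) * (c * m2 / 4) / real n) powr (real S / (2 * real S + 1))"
  shows "1 - (64 * C\<^sup>2 * B / (c\<^sup>2 * m2 * (real n * h)) + B * m2 / (real n * h * a\<^sup>2))
    \<le> \<P>(\<omega> in sample n f. \<bar>fhat K n h \<omega> - f 0\<bar> \<le> rbar S K d n t \<omega>)"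
proof -
  interpret prob_space "sample n f" by (rule prob_space_sample[OF f])
  let ?G = "{\<omega>\<in>space (sample n f). \<bar>fhat K n h \<omega> - f 0\<bar> \<le> rbar S K d n t \<omega>}"
  let ?V = "{\<omega>\<in>space (sample n f). V_proxy K n h \<omega> < c * m2 / 4}"
  let ?F = "{\<omega>\<in>space (sample n f). a \<le> \<bar>fhat K n h \<omega> - (\<integral>x. K (x / h) \<partial>D) / h\<bar>}"
  have "space (sample n f) - ?G \<subseteq> ?V \<union> ?F"
  proof (rule ccontr)
    assume "\<not> ?thesis"
    then obtain \<omega> where 1: "\<not> \<bar>fhat K n h \<omega> - f 0\<bar> \<le> rbar S K d n t \<omega>"
      and 2: "c * m2 / 4 \<le> V_proxy K n h \<omega>"
      and 3: "\<bar>fhat K n h \<omega> - (\<integral>x. K (x / h) \<partial>D) / h\<bar> < a"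
      by (force simp: not_less not_le)
    have "d n * (2 * ln (1 / t) * (c * m2 / 4) / real n) powr (real S / (2 * real S + 1)) \<le> rbar S K d n t \<omega>"
      unfolding rbar_def hn[symmetric]
      using 2 assms(7-9) \<open>m2 > 0\<close> c
      by (intro mult_left_mono powr_mono2 divide_right_mono) auto
    with 1 3 bias le show False by linarith
  qed
  then have "prob (space (sample n f) - ?G) \<le> prob (?V \<union> ?F)"
    by (intro finite_measure_mono) measurable
  also have "\<dots> \<le> prob ?V + prob ?F"
    by (intro measure_Un_le) measurable
  also have "\<dots> \<le> 64 * C\<^sup>2 * B / (c\<^sup>2 * m2 * (real n * h)) + B * m2 / (real n * h * a\<^sup>2)"
    using V_proxy_lower_tail[OF assms(1-4)] fhat_deviation[OF \<open>n > 0\<close> \<open>a > 0\<close>] by linarith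
  finally show ?thesis
    by (subst (asm) prob_compl) auto
qed

end

text \<open>
  The thresholds on \<open>n\<close> come from limits that involve only \<open>\<alpha>\<close>, \<open>d\<close>, the kernel and the constants of
  the class; the density enters after them, which makes the bound uniform. Each of the two tail
  bounds of \<open>coverage\<close> is brought below \<open>\<alpha> / 2\<close>.
\<close>

lemma uniform_coverage:
  fixes S :: nat and I :: "real set" and K r :: "real \<Rightarrow> real"
    and M c B \<delta> \<alpha> :: real and d :: "nat \<Rightarrow> real"
  assumes S: "S \<ge> 1"
    and I: "I = {-1..1} \<or> I = {0..1} \<or> I = {-1..0}"
    and K: "order_kernel I S K"
    and M: "M > 0"
    and r: "r 1 \<ge> 0" "mono_on {0..} r"
    and c: "c > 0" and \<delta>: "\<delta> > 0"
    and \<alpha>: "0 < \<alpha>" "\<alpha> < 1"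
    and d: "filterlim d at_top sequentially"
  shows "\<forall>\<^sub>F n in sequentially. d n \<ge> 0 \<and> (even n \<longrightarrow>
    (\<forall>f \<in> densities I c B \<delta> \<inter> Theta0 S M r (psi S n).
       1 - \<alpha> \<le> \<P>(\<omega> in sample n f. \<bar>fhat K n (h_nv S n) \<omega> - f 0\<bar> \<le> rbar S K d n \<alpha> \<omega>)))"
proof -
  obtain C where C: "\<bar>K u\<bar> \<le> C" for u
    using K by (auto simp: order_kernel_def bounded_iff)
  have outside: "K u = 0" if "u \<notin> I" for u
    using K that closure_subset[of "supp K"] by (auto simp: order_kernel_def supp_def)
  interpret bounded_kernel I K C
    by unfold_locales (use I K C outside in \<open>auto simp: order_kernel_def\<close>)
  have restrict: "(LINT u:I|lborel. g u * K u) = (\<integral>u. g u * K u \<partial>lborel)" for g :: "real \<Rightarrow> real"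
    unfolding set_lebesgue_integral_def
    by (intro Bochner_Integration.integral_cong) (auto simp: indicator_def outside)
  have one: "(\<integral>u. K u \<partial>lborel) = 1"
    using K restrict[of "\<lambda>_. 1"] by (simp add: order_kernel_def)
  have mom: "(\<integral>u. u ^ k * K u \<partial>lborel) = 0" if "k \<in> {1..S}" for k
    using K that restrict[of "\<lambda>u. u ^ k"] by (simp add: order_kernel_def)
  have m2: "m2 > 0"
    using one by (intro m2_pos) simp

  define p where "p = real S / (2 * real S + 1)"
  define L where "L = (2 * ln (1 / \<alpha>) * (c * m2 / 4)) powr p"
  define A where "A = M * r 1 * m1"
  let ?h = "h_nv S"
  have ln_pos: "ln (1 / \<alpha>) > 0"
    using \<alpha> by (simp add: ln_gt_zero)
  then have L: "L > 0"
    using c m2 by (simp add: L_def)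
  have h_pow: "?h n ^ S = real n powr (- p)" if "n > 0" for n
    using that by (simp add: h_nv_def p_def powr_power field_simps)
  have nh: "real n * ?h n = real n powr (2 * p)" if "n > 0" for n
  proof -
    have "real n * ?h n = real n powr (1 + - 1 / (2 * real S + 1))"
      by (simp only: h_nv_def powr_add powr_one of_nat_0_le_iff)
    also have "1 + - 1 / (2 * real S + 1) = 2 * p"
      by (simp add: p_def field_simps)
    finally show ?thesis .
  qed
  have pp: "(real n powr p)\<^sup>2 = real n * ?h n" if "n > 0" for n
    using that nh by (simp add: powr_power mult.commute)

  have h_lim: "?h \<longlonglongrightarrow> 0"
    unfolding h_nv_def by (intro tendsto_neg_powr filterlim_real_sequentially) simp
  have d_lim: "(\<lambda>n. inverse (d n)) \<longlonglongrightarrow> 0"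
    using d by (intro tendsto_inverse_0_at_top)
  have ev: "\<forall>\<^sub>F n in sequentially. x n < y" if "x \<longlonglongrightarrow> 0" "y > 0" for x :: "nat \<Rightarrow> real" and y
    using that by (rule order_tendstoD(2))
  have "\<forall>\<^sub>F n in sequentially. ?h n < \<delta>" "\<forall>\<^sub>F n in sequentially. ?h n < 1"
    using ev[OF h_lim] \<delta> by auto
  moreover have "\<forall>\<^sub>F n in sequentially. ?h n * (B * m1)\<^sup>2 < c * m2 / 2"
    using c m2 by (intro ev tendsto_mult_left_zero h_lim) auto
  moreover have "\<forall>\<^sub>F n in sequentially. 64 * C\<^sup>2 * B / (c\<^sup>2 * m2) * real n powr (- (2 * p)) < \<alpha> / 2"
  proof (intro ev tendsto_mult_right_zero)
    show "(\<lambda>n. real n powr (- (2 * p))) \<longlonglongrightarrow> 0"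
      using S by (intro tendsto_neg_powr filterlim_real_sequentially) (simp add: p_def)
  qed (use \<alpha> in auto)
  moreover have "\<forall>\<^sub>F n in sequentially. 4 * B * m2 / L\<^sup>2 * (inverse (d n))\<^sup>2 < \<alpha> / 2"
    using \<alpha> tendsto_power[OF d_lim, of 2] by (intro ev tendsto_mult_right_zero) auto
  moreover have "\<forall>\<^sub>F n in sequentially. d n \<ge> max 1 (2 * A / L)"
    using d unfolding filterlim_at_top by blast
  moreover have "\<forall>\<^sub>F n in sequentially. n \<ge> 3"
    by (rule eventually_ge_at_top)
  ultimately show ?thesis
  proof eventually_elim
    case (elim n)
    then have n: "n > 0" and d1: "d n \<ge> 1" "d n \<ge> 2 * A / L" by auto
    have "1 - \<alpha> \<le> \<P>(\<omega> in sample n f. \<bar>fhat K n (?h n) \<omega> - f 0\<bar> \<le> rbar S K d n \<alpha> \<omega>)"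
      if "even n" and mem: "f \<in> densities I c B \<delta>" "f \<in> Theta0 S M r (psi S n)" for f
    proof -
      have hpos: "?h n > 0"
        using n by (simp add: h_nv_def)
      interpret kernel_density I K C f c B \<delta> "?h n"
        by unfold_locales (use mem c \<delta> elim hpos in auto)
      \<comment> \<open>\<open>n \<ge> 3\<close> gives \<open>ln n \<ge> 1\<close>, so the bandwidth lies in the window of the smoothness condition\<close>
      have "exp 1 \<le> real n"
        using exp_le elim by linarith
      then have "1 \<le> ln (real n)"
        using n by (subst ln_ge_iff) auto
      then have "?h n * 1 \<le> ?h n * ln (real n)"
        using hpos by (intro mult_left_mono) auto
      then have h_psi: "?h n \<le> psi S n"
        by (simp add: psi_def h_nv_def)
      \<comment> \<open>half of the guaranteed width; the other half absorbs the bias\<close>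
      define a where "a = d n * L / 2 * real n powr (- p)"
      have a: "a > 0"
        using d1 L n by (simp add: a_def)
      have "2 * A \<le> d n * L"
        using d1 L by (simp add: divide_le_eq)
      then have "A * real n powr (- p) \<le> d n * L / 2 * real n powr (- p)"
        by (intro mult_right_mono) auto
      then have "a + A * real n powr (- p) \<le> d n * (L * real n powr (- p))"
        by (simp add: a_def algebra_simps)
      also have "L * real n powr (- p) = (2 * ln (1 / \<alpha>) * (c * m2 / 4) / real n) powr p"
        using ln_pos c m2 n unfolding L_def
        by (subst powr_divide) (auto simp: powr_minus field_simps)
      finally have le: "a + A * real n powr (- p)
          \<le> d n * (2 * ln (1 / \<alpha>) * (c * m2 / 4) / real n) powr (real S / (2 * real S + 1))"
        unfolding p_def .
      have bias: "\<bar>(\<integral>x. K (x / ?h n) \<partial>D) / ?h n - f 0\<bar> \<le> A * real n powr (- p)"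
        using bias_bound[OF mem(2) h_psi _ M r(2,1) one mom] elim h_pow[OF n] by (simp add: A_def)
      have "64 * C\<^sup>2 * B / (c\<^sup>2 * m2 * (real n * ?h n)) = 64 * C\<^sup>2 * B / (c\<^sup>2 * m2) * real n powr (- (2 * p))"
        unfolding nh[OF n] by (simp add: powr_minus field_simps)
      moreover have "B * m2 / (real n * ?h n * a\<^sup>2) = 4 * B * m2 / L\<^sup>2 * (inverse (d n))\<^sup>2"
      proof -
        have "real n * ?h n * a\<^sup>2 = (real n powr p * a)\<^sup>2"
          using pp[OF n] by (simp add: power_mult_distrib)
        also have "real n powr p * a = d n * L / 2"
          using n by (simp add: a_def powr_minus)
        finally have sq: "real n * ?h n * a\<^sup>2 = (d n * L / 2)\<^sup>2" .
        show ?thesis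
          unfolding sq using d1 L by (simp add: field_simps power2_eq_square)
      qed
      moreover have "1 - (64 * C\<^sup>2 * B / (c\<^sup>2 * m2 * (real n * ?h n)) + B * m2 / (real n * ?h n * a\<^sup>2))
          \<le> \<P>(\<omega> in sample n f. \<bar>fhat K n (?h n) \<omega> - f 0\<bar> \<le> rbar S K d n \<alpha> \<omega>)"
        by (rule coverage[where d=d and n=n, OF \<open>even n\<close> n m2 _ _ bias a _ _ le]) (use elim d1 ln_pos in \<open>auto simp: h_nv_def\<close>)
      ultimately show ?thesis
        using elim by linarith
    qed
    then show ?case using d1 by auto
  qed
qed

lemma rbar_antimono:
  assumes "0 < s" "s \<le> t" "t \<le> 1" "d n \<ge> 0"
  shows "rbar S K d n t \<omega> \<le> rbar S K d n s \<omega>"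
proof -
  have V: "0 \<le> V_proxy K n (real n powr (- 1 / (2 * real S + 1))) \<omega>"
    unfolding V_proxy_def by (intro mult_nonneg_nonneg sum_nonneg) auto
  have "0 \<le> ln (1 / t)" "ln (1 / t) \<le> ln (1 / s)"
    using assms by (auto simp: ln_div)
  with V assms(4) show ?thesis
    unfolding rbar_def
    by (intro mult_left_mono powr_mono2 divide_right_mono mult_right_mono mult_nonneg_nonneg divide_nonneg_nonneg) auto
qed

theorem theorem5:
  fixes S :: nat and I :: "real set" and K r :: "real \<Rightarrow> real"
    and M c B \<delta> \<alpha> :: real and d :: "nat \<Rightarrow> real"
  assumes "S \<ge> 1"
    and "I = {-1..1} \<or> I = {0..1} \<or> I = {-1..0}"
    and "order_kernel I S K"
    and "M > 0"
    and "\<And>t. t \<ge> 0 \<Longrightarrow> r t \<ge> 0" and "mono_on {0..} r" and "(r \<longlongrightarrow> 0) (at_right 0)"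
    and "c > 0" and "\<delta> > 0"
    and "0 < \<alpha>" and "\<alpha> < 1"
    and "filterlim d at_top sequentially"
    and "filterlim (\<lambda>n. d n / ln (real n)) at_top sequentially"
  shows "\<exists>(CE :: nat \<Rightarrow> real) (CE' :: nat \<Rightarrow> real) \<kappa>1 \<kappa>2. \<kappa>1 > 0 \<and> \<kappa>2 > 0 \<and>
    CE \<in> O(\<lambda>n. exp (- (real n powr \<kappa>1))) \<and>
    CE' \<in> O(\<lambda>n. exp (- (real n powr \<kappa>2))) \<and>
    (\<forall>n. even n \<and> n > 0 \<longrightarrow>
      (INF f \<in> densities I c B \<delta> \<inter> Theta0 S M r (psi S n).
         ereal \<P>(\<omega> in sample n f. fhat K n (h_nv S n) \<omega> \<ge> f 0 - rbar S K d n \<alpha> \<omega>))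
        \<ge> ereal (1 - \<alpha> - CE n) \<and>
      (INF f \<in> densities I c B \<delta> \<inter> Theta0 S M r (psi S n).
         ereal \<P>(\<omega> in sample n f. f 0 \<ge> fhat K n (h_nv S n) \<omega> - rbar S K d n \<alpha> \<omega>))
        \<ge> ereal (1 - \<alpha> - CE n) \<and>
      (INF f \<in> densities I c B \<delta> \<inter> Theta0 S M r (psi S n).
         ereal \<P>(\<omega> in sample n f.
           f 0 \<in> {fhat K n (h_nv S n) \<omega> - rbar S K d n (\<alpha> / 2) \<omega> ..
                   fhat K n (h_nv S n) \<omega> + rbar S K d n (\<alpha> / 2) \<omega>}))
        \<ge> ereal (1 - \<alpha> - CE' n))"
proof -
  let ?F = "\<lambda>n. densities I c B \<delta> \<inter> Theta0 S M r (psi S n)"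
  let ?good = "\<lambda>n f \<omega>. \<bar>fhat K n (h_nv S n) \<omega> - f 0\<bar> \<le> rbar S K d n \<alpha> \<omega>"
  obtain N where N: "\<And>n. n \<ge> N \<Longrightarrow> d n \<ge> 0"
    "\<And>n f. n \<ge> N \<Longrightarrow> even n \<Longrightarrow> f \<in> ?F n \<Longrightarrow> 1 - \<alpha> \<le> \<P>(\<omega> in sample n f. ?good n f \<omega>)"
    using uniform_coverage[OF assms(1-4) assms(5)[of 1] assms(6,8-12), of B]
    unfolding eventually_sequentially by auto
  define CE :: "nat \<Rightarrow> real" where "CE n = (if n < N then 1 else 0)" for n
  have CE: "CE \<in> O(\<lambda>n. exp (- (real n powr 1)))"
  proof (rule landau_o.bigI[where c=1])
    show "\<forall>\<^sub>F n in sequentially. norm (CE n) \<le> 1 * norm (exp (- (real n powr 1)))"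
      using eventually_ge_at_top[of N] by eventually_elim (simp add: CE_def)
  qed simp
  \<comment> \<open>any event implied by an error of at most \<open>rbar\<close> at level \<open>\<alpha>\<close> inherits the uniform bound\<close>
  have lower: "ereal (1 - \<alpha> - CE n) \<le> (INF f \<in> ?F n. ereal \<P>(\<omega> in sample n f. P f \<omega>))"
    if "even n"
      and imp: "\<And>f \<omega>. n \<ge> N \<Longrightarrow> ?good n f \<omega> \<Longrightarrow> P f \<omega>"
      and meas: "\<And>f. f \<in> ?F n \<Longrightarrow> Measurable.pred (sample n f) (P f)"
    for n P
  proof (rule INF_greatest)
    fix f assume f: "f \<in> ?F n"
    interpret prob_space "sample n f"
      using f by (intro prob_space_sample[where I=I]) auto
    show "ereal (1 - \<alpha> - CE n) \<le> ereal \<P>(\<omega> in sample n f. P f \<omega>)"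
    proof (cases "n < N")
      case True
      then have "1 - \<alpha> - CE n \<le> 0"
        using assms by (simp add: CE_def)
      also have "0 \<le> \<P>(\<omega> in sample n f. P f \<omega>)"
        by simp
      finally show ?thesis by simp
    next
      case False
      then have "1 - \<alpha> - CE n \<le> \<P>(\<omega> in sample n f. ?good n f \<omega>)"
        using N(2)[of n f] that f by (simp add: CE_def)
      also have "\<dots> \<le> \<P>(\<omega> in sample n f. P f \<omega>)"
        using imp False meas[OF f, unfolded pred_def] by (intro finite_measure_mono) auto
      finally show ?thesis by simp
    qed
  qed
  have K [measurable]: "K \<in> borel_measurable borel"
    using assms(3) by (simp add: order_kernel_def)
  show ?thesis
  proof (intro exI[of _ CE] exI[of _ "1::real"] conjI allI impI CE)
    fix n :: nat assume n: "even n \<and> n > 0"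
    have half: "rbar S K d n \<alpha> \<omega> \<le> rbar S K d n (\<alpha> / 2) \<omega>" if "n \<ge> N" for \<omega>
      using assms N(1)[OF that] by (intro rbar_antimono) auto
    show "ereal (1 - \<alpha> - CE n) \<le> (INF f \<in> ?F n.
         ereal \<P>(\<omega> in sample n f. fhat K n (h_nv S n) \<omega> \<ge> f 0 - rbar S K d n \<alpha> \<omega>))"
    proof (rule lower)
      show "Measurable.pred (sample n f) (\<lambda>\<omega>. fhat K n (h_nv S n) \<omega> \<ge> f 0 - rbar S K d n \<alpha> \<omega>)" for f
        unfolding pred_def by (intro borel_measurable_le borel_measurable_diff borel_measurable_const
            fhat_measurable rbar_measurable K)
    qed (use n in \<open>auto simp: abs_le_iff\<close>)
    show "ereal (1 - \<alpha> - CE n) \<le> (INF f \<in> ?F n.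
         ereal \<P>(\<omega> in sample n f. f 0 \<ge> fhat K n (h_nv S n) \<omega> - rbar S K d n \<alpha> \<omega>))"
    proof (rule lower)
      show "Measurable.pred (sample n f) (\<lambda>\<omega>. f 0 \<ge> fhat K n (h_nv S n) \<omega> - rbar S K d n \<alpha> \<omega>)" for f
        by measurable
    qed (use n in \<open>auto simp: abs_le_iff\<close>)
    show "ereal (1 - \<alpha> - CE n) \<le> (INF f \<in> ?F n.
         ereal \<P>(\<omega> in sample n f.
           f 0 \<in> {fhat K n (h_nv S n) \<omega> - rbar S K d n (\<alpha> / 2) \<omega> ..
                   fhat K n (h_nv S n) \<omega> + rbar S K d n (\<alpha> / 2) \<omega>}))"
    proof (rule lower)
      show "f 0 \<in> {fhat K n (h_nv S n) \<omega> - rbar S K d n (\<alpha> / 2) \<omega> ..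
                   fhat K n (h_nv S n) \<omega> + rbar S K d n (\<alpha> / 2) \<omega>}"
        if "n \<ge> N" "?good n f \<omega>" for f \<omega>
        using that(2) half[OF that(1), of \<omega>] by (auto simp: abs_le_iff)
      show "Measurable.pred (sample n f) (\<lambda>\<omega>. f 0 \<in> {fhat K n (h_nv S n) \<omega> - rbar S K d n (\<alpha> / 2) \<omega> ..
                   fhat K n (h_nv S n) \<omega> + rbar S K d n (\<alpha> / 2) \<omega>})" for f
        unfolding atLeastAtMost_iff by measurable
    qed (use n in auto)
  qed auto
qed

end
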